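(* There exist infinitely many positive integers $k$ such that $$\lim_{N \to \infty}\frac{\#\{0 \le n \le N : p(n,k) \text{ is odd}\}}{N} \le \frac{2}{3}.$$
   Context: For a nonnegative integer $n$ and a positive integer $k$, $p(n,k)$ denotes the number of partitions of $n$ into parts each less than or equal to $k$ (so $p(0,k)=1$); equivalently, $\sum_{n\ge 0} p(n,k)q^n = \prod_{i=1}^{k} \frac{1}{1-q^i}$. *)

theory Defs
  imports Complex_Main "HOL-Library.Multiset"
begin

definition partitions_le :: "nat \<Rightarrow> nat \<Rightarrow> nat multiset set" where
  "partitions_le n k = {M. sum_mset M = n \<and> (\<forall>i\<in>#M. 1 \<le> i \<and> i \<le> k)}"

definition num_partitions_le :: "nat \<Rightarrow> nat \<Rightarrow> nat" where
  "num_partitions_le n k = card (partitions_le n k)"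

lemma finite_partitions_le: "finite (partitions_le n k)"
proof -
  have "M \<in> mset ` {xs. set xs \<subseteq> {1..k} \<and> length xs \<le> n}"
    if M: "M \<in> partitions_le n k" for M
  proof -
    obtain xs where xs: "M = mset xs" by (metis ex_mset)
    have "\<forall>i\<in>set ys. 1 \<le> i \<Longrightarrow> length ys \<le> sum_list ys" for ys :: "nat list"
      by (induction ys) auto
    from this[of xs] M have "set xs \<subseteq> {1..k} \<and> length xs \<le> n"
      by (auto simp: partitions_le_def xs sum_mset_sum_list)
    then show ?thesis using xs by blast
  qed
  then have "partitions_le n k \<subseteq> mset ` {xs. set xs \<subseteq> {1..k} \<and> length xs \<le> n}"
    by blast
  then show ?thesis
    by (rule finite_subset) (simp add: finite_lists_length_le)
qed

lemma num_partitions_le_0: "num_partitions_le 0 k = 1"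
proof -
  have "partitions_le 0 k = {{#}}"
    by (auto simp: partitions_le_def) (metis Suc_n_not_le_n multiset_nonemptyE)
  then show ?thesis by (simp add: num_partitions_le_def)
qed

end

theory Submission imports Defs "HOL-Library.Infinite_Set" begin

text \<open>
  Let \<open>\<delta>\<^sub>k\<close> be the density of the set of \<open>n\<close> for which \<open>p(n,k)\<close> is odd; it exists because
  \<open>p(n,k)\<close> modulo 2 is eventually periodic in \<open>n\<close>. If \<open>p(n,k-1) = p(n,k) - p(n-k,k)\<close> is odd, then
  one of \<open>p(n,k)\<close>, \<open>p(n-k,k)\<close> is even, so \<open>\<delta>\<^bsub>k-1\<^esub> \<le> 2 (1 - \<delta>\<^sub>k)\<close>. Therefore at least one of two
  consecutive densities is at most \<open>2/3\<close>.
\<close>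

text \<open>Split by whether \<open>Suc k\<close> occurs as a part: if so, deleting one copy leaves
  a partition of \<open>n\<close> with parts still at most \<open>Suc k\<close>; if not, all parts
  are at most \<open>k\<close>.\<close>

lemma num_partitions_le_add_Suc:
  "num_partitions_le (n + Suc k) (Suc k) = num_partitions_le n (Suc k) + num_partitions_le (n + Suc k) k"
proof -
  have "partitions_le (n + Suc k) (Suc k) =
      add_mset (Suc k) ` partitions_le n (Suc k) \<union> partitions_le (n + Suc k) k" (is "?A = ?B")
  proof
    show "?B \<subseteq> ?A"
      by (fastforce simp: partitions_le_def)
    show "?A \<subseteq> ?B"
    proof
      fix M assume M: "M \<in> ?A"
      show "M \<in> ?B"
      proof (cases "Suc k \<in># M")
        case True
        then obtain M' where "M = add_mset (Suc k) M'"
          by (metis insert_DiffM)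
        with M show ?thesis
          by (auto simp: partitions_le_def)
      next
        case False
        with M show ?thesis
          by (auto simp: partitions_le_def le_Suc_eq)
      qed
    qed
  qed
  moreover have "add_mset (Suc k) ` partitions_le n (Suc k) \<inter> partitions_le (n + Suc k) k = {}"
    by (auto simp: partitions_le_def)
  ultimately show ?thesis
    unfolding num_partitions_le_def
    by (simp add: card_Un_disjoint finite_partitions_le card_image inj_on_def)
qed

lemma num_partitions_le_add_mult:
  "num_partitions_le (n + m * Suc k) (Suc k) =
     num_partitions_le n (Suc k) + (\<Sum>j<m. num_partitions_le (n + Suc j * Suc k) k)"
proof (induction m)
  case (Suc m)
  show ?case
    using num_partitions_le_add_Suc[of "n + m * Suc k" k] Suc by (simp add: algebra_simps)
qed simp

lemma num_partitions_le_zero_right: "n > 0 \<Longrightarrow> num_partitions_le n 0 = 0"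
  by (auto simp: num_partitions_le_def partitions_le_def card_eq_0_iff)

text \<open>The preperiod \<open>n0\<close> accommodates \<open>k = 0\<close>, where the set of
  interest is \<open>{0}\<close>.\<close>

definition eventually_periodic :: "nat set \<Rightarrow> bool" where
  "eventually_periodic S \<longleftrightarrow> (\<exists>P>0. \<exists>n0. \<forall>n\<ge>n0. n + P \<in> S \<longleftrightarrow> n \<in> S)"

lemma periodic_mult:
  fixes S :: "nat set"
  assumes "\<forall>n\<ge>n0. n + P \<in> S \<longleftrightarrow> n \<in> S" "n \<ge> n0"
  shows "n + P * m \<in> S \<longleftrightarrow> n \<in> S"
proof (induction m)
  case (Suc m)
  have "n + P * m + P \<in> S \<longleftrightarrow> n + P * m \<in> S"
    using assms by simp
  then show ?case
    using Suc by (simp add: algebra_simps)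
qed simp

text \<open>If \<open>P\<close> is a period for \<open>k\<close>, unfold the recurrence for
  \<open>Suc k\<close> exactly \<open>2 * P\<close> times. The summands with indices
  \<open>j\<close> and \<open>P + j\<close> have arguments differing by \<open>P * Suc k\<close>, so
  they agree in parity and cancel modulo 2. Hence \<open>2 * P * Suc k\<close> is a period for
  \<open>Suc k\<close>.\<close>

lemma eventually_periodic_odd_num_partitions_le:
  "eventually_periodic {n. odd (num_partitions_le n k)}"
proof (induction k)
  case 0
  show ?case
    unfolding eventually_periodic_def
    by (rule exI[of _ 1]) (auto intro!: exI[of _ 1] simp: num_partitions_le_zero_right)
next
  case (Suc k)
  then obtain P n0 where P: "P > 0"
    and per: "\<forall>n\<ge>n0. n + P \<in> {n. odd (num_partitions_le n k)} \<longleftrightarrow> n \<in> {n. odd (num_partitions_le n k)}"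
    unfolding eventually_periodic_def by blast
  have "odd (num_partitions_le (n + 2 * P * Suc k) (Suc k)) = odd (num_partitions_le n (Suc k))"
    if "n \<ge> n0" for n
  proof -
    let ?b = "\<lambda>j. num_partitions_le (n + Suc j * Suc k) k"
    \<comment> \<open>The second block has variable length \<open>m\<close> so that the induction
      leaves \<open>P\<close> fixed; only \<open>m = P\<close> is used.\<close>
    have "(\<Sum>j<P + m. ?b j) = (\<Sum>j<P. ?b j) + (\<Sum>j<m. ?b (P + j))" for m
      by (induction m) simp_all
    from this[of P] have "(\<Sum>j<2 * P. ?b j) = (\<Sum>j<P. ?b j) + (\<Sum>j<P. ?b (P + j))"
      by (simp only: mult_2)
    also have "\<dots> = (\<Sum>j<P. ?b j + ?b (P + j))"
      by (simp add: sum.distrib)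
    also have "even \<dots>"
    proof (intro dvd_sum)
      fix j
      have "n + Suc (P + j) * Suc k = n + Suc j * Suc k + P * Suc k"
        by (simp add: algebra_simps)
      then have "odd (?b (P + j)) = odd (?b j)"
        using periodic_mult[OF per, of "n + Suc j * Suc k" "Suc k"] that
        by (simp only: mem_Collect_eq trans_le_add1)
      then show "even (?b j + ?b (P + j))" by simp
    qed
    finally show ?thesis
      by (simp only: num_partitions_le_add_mult even_add) simp
  qed
  with P show ?case
    unfolding eventually_periodic_def
    by (intro exI[of _ "2 * P * Suc k"]) (auto intro!: exI[of _ n0])
qed

lemma eventually_periodic_real_bounded:
  fixes f :: "nat \<Rightarrow> real"
  assumes "P > 0" "\<And>n. n \<ge> n0 \<Longrightarrow> f (n + P) = f n"
  shows "\<exists>B. \<forall>n. \<bar>f n\<bar> \<le> B"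
proof -
  define B where "B = Max ((\<lambda>n. \<bar>f n\<bar>) ` {..n0 + P})"
  have "\<bar>f n\<bar> \<le> B" for n
  proof (induction n rule: less_induct)
    case (less n)
    show ?case
    proof (cases "n \<le> n0 + P")
      case True
      then show ?thesis by (auto simp: B_def)
    next
      case False
      \<comment> \<open>Here \<open>n - P\<close> is still at least \<open>n0\<close> and smaller
        than \<open>n\<close>, so the value at \<open>n\<close> repeats one already bounded.\<close>
      then show ?thesis
        using less[of "n - P"] assms(1) assms(2)[of "n - P"] by simp
    qed
  qed
  then show ?thesis by blast
qed

lemma card_le_Suc:
  "card {n. n \<le> Suc N \<and> n \<in> S} = card {n. n \<le> N \<and> n \<in> S} + of_bool (Suc N \<in> S)"
proof -
  have "{n. n \<le> Suc N \<and> n \<in> S} = {n. n \<le> N \<and> n \<in> S} \<union> (if Suc N \<in> S then {Suc N} else {})"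
    by (auto simp: le_Suc_eq)
  then show ?thesis by simp
qed

text \<open>Beyond \<open>n0\<close> the counting function grows by the same amount \<open>c\<close>
  over every period. Subtracting the linear function of slope \<open>c / P\<close> leaves an
  eventually periodic, hence bounded, remainder, so the density is \<open>c / P\<close>.\<close>

lemma eventually_periodic_density_exists:
  assumes "eventually_periodic S"
  shows "\<exists>L. (\<lambda>N. real (card {n. n \<le> N \<and> n \<in> S}) / real N) \<longlonglongrightarrow> L"
proof -
  obtain P n0 where P: "P > 0" and per: "\<And>n. n \<ge> n0 \<Longrightarrow> n + P \<in> S \<longleftrightarrow> n \<in> S"
    using assms unfolding eventually_periodic_def by blast
  define C where "C N = real (card {n. n \<le> N \<and> n \<in> S})" for N
  define c where "c = C (n0 + P) - C n0"
  have C_Suc: "C (Suc N) = C N + of_bool (Suc N \<in> S)" for N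
    unfolding C_def card_le_Suc by simp
  have step: "C (N + P) = C N + c" if "N \<ge> n0" for N
    using that
  proof (induction N rule: dec_induct)
    case base
    then show ?case by (simp add: c_def)
  next
    case (step N)
    \<comment> \<open>Passing from \<open>N\<close> to \<open>Suc N\<close> changes both sides by
      the same indicator, since \<open>Suc N + P\<close> and \<open>Suc N\<close> are both in
      \<open>S\<close> or both outside.\<close>
    then show ?case
      using per[of "Suc N"] by (simp add: C_Suc)
  qed
  define f where "f N = C N - c / real P * real N" for N
  have "f (N + P) = f N" if "N \<ge> n0" for N
    using step[OF that] P by (simp add: f_def field_simps)
  then obtain B where B: "\<And>N. \<bar>f N\<bar> \<le> B"
    using eventually_periodic_real_bounded[OF P] by blast
  have "(\<lambda>N. f N / real N) \<longlonglongrightarrow> 0"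
  proof (rule tendsto_rabs_zero_cancel, rule tendsto_sandwich)
    show "\<forall>\<^sub>F N in sequentially. 0 \<le> \<bar>f N / real N\<bar>" by simp
    show "\<forall>\<^sub>F N in sequentially. \<bar>f N / real N\<bar> \<le> B / real N"
      using B by (auto simp: abs_divide intro!: always_eventually divide_right_mono)
    show "(\<lambda>N. B / real N) \<longlonglongrightarrow> 0" by (rule lim_const_over_n)
  qed simp
  then have "(\<lambda>N. f N / real N + c / real P) \<longlonglongrightarrow> 0 + c / real P"
    by (intro tendsto_intros)
  \<comment> \<open>At \<open>N = 0\<close> both quotients are 0 by convention, so the identity is
    taken for \<open>N > 0\<close> only.\<close>
  moreover have "\<forall>\<^sub>F N in sequentially. f N / real N + c / real P = C N / real N"
    using eventually_gt_at_top[of 0] by eventually_elim (simp add: f_def field_simps)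
  ultimately have "(\<lambda>N. C N / real N) \<longlonglongrightarrow> 0 + c / real P"
    by (rule Lim_transform_eventually)
  then show ?thesis unfolding C_def by blast
qed

text \<open>For \<open>n > k\<close> with \<open>p(n,k)\<close> odd, the recurrence puts
  \<open>n\<close> or \<open>n - Suc k\<close> into the set \<open>E\<close> of even values for
  \<open>Suc k\<close>. So \<open>E\<close> and its shift cover all such \<open>n\<close>, and
  \<open>{..k}\<close> covers the rest. With \<open>card E = N + 1 - card ?O\<close> the constant is
  \<open>(k + 1) + 2 * (N + 1)\<close>.\<close>

lemma card_odd_num_partitions_le_bound:
  "card {n. n \<le> N \<and> odd (num_partitions_le n k)} + 2 * card {n. n \<le> N \<and> odd (num_partitions_le n (Suc k))}
     \<le> 2 * N + k + 3"
proof -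
  define E where "E = {n. n \<le> N \<and> even (num_partitions_le n (Suc k))}"
  let ?O = "{n. n \<le> N \<and> odd (num_partitions_le n (Suc k))}"
  have "{n. n \<le> N \<and> odd (num_partitions_le n k)} \<subseteq> {..k} \<union> (E \<union> (\<lambda>n. n + Suc k) ` E)"
  proof
    fix n assume n: "n \<in> {n. n \<le> N \<and> odd (num_partitions_le n k)}"
    show "n \<in> {..k} \<union> (E \<union> (\<lambda>n. n + Suc k) ` E)"
    proof (cases "n \<le> k")
      case False
      then obtain m where m: "n = m + Suc k"
        by (metis add.commute less_eqE not_less_eq_eq)
      have "odd (num_partitions_le m (Suc k)) \<noteq> odd (num_partitions_le n (Suc k))"
        using n num_partitions_le_add_Suc[of m k] m by auto
      then show ?thesis
        using n m by (auto simp: E_def)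
    qed simp
  qed
  moreover have fin: "finite E" by (simp add: E_def)
  ultimately have "card {n. n \<le> N \<and> odd (num_partitions_le n k)} \<le>
      card ({..k} \<union> (E \<union> (\<lambda>n. n + Suc k) ` E))"
    by (intro card_mono) auto
  also have "\<dots> \<le> card {..k} + (card E + card ((\<lambda>n. n + Suc k) ` E))"
    by (meson card_Un_le add_left_mono le_trans)
  also have "\<dots> \<le> Suc k + (card E + card E)"
    using card_image_le[OF fin, of "\<lambda>n. n + Suc k"] by simp
  finally have 1: "card {n. n \<le> N \<and> odd (num_partitions_le n k)} \<le> Suc k + (card E + card E)" .
  have "card E + card ?O = card (E \<union> ?O)"
    by (rule card_Un_disjoint[symmetric]) (auto simp: E_def)
  also have "E \<union> ?O = {..N}" by (auto simp: E_def)
  finally have "card E + card ?O = Suc N" by simp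
  with 1 show ?thesis by linarith
qed

theorem theorem1p2:
  "infinite {k::nat. k > 0 \<and>
     (\<exists>L::real. (\<lambda>N::nat. real (card {n. n \<le> N \<and> odd (num_partitions_le n k)}) / real N) \<longlonglongrightarrow> L \<and> L \<le> 2 / 3)}"
  (is "infinite ?S")
proof -
  define d where "d k N = real (card {n. n \<le> N \<and> odd (num_partitions_le n k)}) / real N" for k N
  have "\<exists>L. d k \<longlonglongrightarrow> L" for k
    using eventually_periodic_density_exists[OF eventually_periodic_odd_num_partitions_le[of k]]
    by (simp add: d_def[abs_def])
  then obtain \<delta> where \<delta>: "\<And>k. d k \<longlonglongrightarrow> \<delta> k" by metis
  \<comment> \<open>Divide the counting bound by \<open>N\<close>; the error
    \<open>(k + 3) / N\<close> vanishes in the limit.\<close>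
  have le: "\<delta> k + 2 * \<delta> (Suc k) \<le> 2" for k
  proof (rule LIMSEQ_le)
    show "(\<lambda>N. d k N + 2 * d (Suc k) N) \<longlonglongrightarrow> \<delta> k + 2 * \<delta> (Suc k)"
      by (intro tendsto_intros \<delta>)
    have "(\<lambda>N. 2 + real (k + 3) / real N) \<longlonglongrightarrow> 2 + 0"
      by (intro tendsto_intros lim_const_over_n)
    then show "(\<lambda>N. 2 + real (k + 3) / real N) \<longlonglongrightarrow> 2" by simp
    have "d k N + 2 * d (Suc k) N \<le> 2 + real (k + 3) / real N" if "N \<ge> 1" for N
    proof -
      have "real (card {n. n \<le> N \<and> odd (num_partitions_le n k)}) +
          2 * real (card {n. n \<le> N \<and> odd (num_partitions_le n (Suc k))}) \<le> 2 * real N + real (k + 3)"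
        using card_odd_num_partitions_le_bound[of N k] by linarith
      then have "(real (card {n. n \<le> N \<and> odd (num_partitions_le n k)}) +
          2 * real (card {n. n \<le> N \<and> odd (num_partitions_le n (Suc k))})) / real N
          \<le> (2 * real N + real (k + 3)) / real N"
        by (rule divide_right_mono) simp
      with that show ?thesis
        by (simp add: d_def add_divide_distrib)
    qed
    then show "\<exists>N0. \<forall>N\<ge>N0. d k N + 2 * d (Suc k) N \<le> 2 + real (k + 3) / real N" by blast
  qed
  have mem: "k \<in> ?S" if "k > 0" "\<delta> k \<le> 2 / 3" for k
    using that \<delta>[of k] by (auto simp: d_def[abs_def])
  show ?thesis
    unfolding infinite_nat_iff_unbounded
  proof
    fix m
    show "\<exists>k>m. k \<in> ?S"
    \<comment> \<open>Starting at \<open>Suc m\<close> gives both positivity and an index above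
      \<open>m\<close>. If its density exceeds 2/3, then \<open>le\<close> makes twice the next one
      less than 4/3.\<close>
    proof (cases "\<delta> (Suc m) \<le> 2 / 3")
      case True
      then show ?thesis using mem[of "Suc m"] by blast
    next
      case False
      then have "\<delta> (Suc (Suc m)) \<le> 2 / 3" using le[of "Suc m"] by simp
      then show ?thesis using mem[of "Suc (Suc m)"] by (meson lessI less_SucI zero_less_Suc)
    qed
  qed
qed

end
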